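(* Let $G$ be an Eulerian digraph with $n$ vertices and $m$ arcs. Then $\beta(G) \ge \frac{m^2}{2n^2} + \frac{m}{2n}$.
   Context: All digraphs are finite and simple: no loops and no multiple arcs, but two arcs in opposite directions $(u,v)$ and $(v,u)$ between the same pair of vertices are allowed. A digraph is Eulerian if every vertex has in-degree equal to its out-degree. A feedback arc set of a digraph is a set of arcs whose removal leaves a digraph with no directed cycle; $\beta(G)$ denotes the minimum size of a feedback arc set of $G$. *)

theory Defs
  imports Complex_Main "Graph_Theory.Arc_Walk"
begin

text \<open>
  The library locale \<^locale>\<open>digraph\<close> is that of finite digraphs without loops and without parallel
  arcs; a pair of opposite arcs is permitted and counts as a directed cycle.
\<close>

definition eulerian :: "('a, 'b) pre_digraph \<Rightarrow> bool" where
  "eulerian G \<longleftrightarrow> (\<forall>v \<in> verts G. in_degree G v = out_degree G v)"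

definition del_arcs :: "('a, 'b) pre_digraph \<Rightarrow> 'b set \<Rightarrow> ('a, 'b) pre_digraph" where
  "del_arcs G F = \<lparr>verts = verts G, arcs = arcs G - F, tail = tail G, head = head G\<rparr>"

definition feedback_arc_set :: "('a, 'b) pre_digraph \<Rightarrow> 'b set \<Rightarrow> bool" where
  "feedback_arc_set G F \<longleftrightarrow>
     F \<subseteq> arcs G \<and> \<not> (\<exists>p. pre_digraph.cycle (del_arcs G F) p)"

text \<open>
  The set under \<^const>\<open>Min\<close> is finite and nonempty for every finite digraph, since the set of all
  arcs is a feedback arc set.
\<close>

definition min_feedback :: "('a, 'b) pre_digraph \<Rightarrow> nat" (\<open>\<beta>\<close>) where
  "\<beta> G = Min (card ` {F. feedback_arc_set G F})"

end

theory Submission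
  imports Defs
begin

text \<open>
  Number the vertices by \<open>0, \<dots>, n - 1\<close> so that every arc outside a minimum feedback arc set goes
  forward, and place them in this order on a circle. Let the cyclic length of an arc from position
  \<open>i\<close> to position \<open>j\<close> be the representative of \<open>j - i\<close> modulo \<open>n\<close> in \<open>{1, \<dots>, n - 1}\<close>. In an Eulerian
  digraph the differences \<open>j - i\<close> sum to zero, so the cyclic lengths sum to \<open>n\<close> times the number of
  backward arcs, which is at most \<open>n \<cdot> \<beta>\<close>. On the other hand each cyclic length is attained by at
  most \<open>n\<close> arcs, so \<open>m\<close> arcs have total cyclic length at least \<open>n \<cdot> x (x + 1) / 2\<close> for \<open>x = m / n\<close>.
\<close>

section \<open>Sums of positive integers with bounded multiplicities\<close>

lemma card_le_mult_of_card_fibre_le: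
  fixes c :: "'a \<Rightarrow> nat"
  assumes pos: "\<And>a. a \<in> A \<Longrightarrow> 0 < c a"
    and fibre: "\<And>d. card {a \<in> A. c a = d} \<le> n"
  shows "card {a \<in> A. c a \<le> d} \<le> n * d"
proof -
  have "{a \<in> A. c a \<le> d} = (\<Union>i\<in>{1..d}. {a \<in> A. c a = i})"
    using pos by (auto simp: Suc_le_eq)
  then have "card {a \<in> A. c a \<le> d} \<le> (\<Sum>i\<in>{1..d}. card {a \<in> A. c a = i})"
    using card_UN_le[of "{1..d}"] by simp
  also have "\<dots> \<le> n * d"
    using sum_bounded_above[of "{1..d}", OF fibre] by (simp add: mult.commute)
  finally show ?thesis .
qed

lemma sum_card_greater_le_sum:
  fixes c :: "'a \<Rightarrow> nat"
  assumes "finite A"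
  shows "(\<Sum>d<K. card {a \<in> A. d < c a}) \<le> (\<Sum>a\<in>A. c a)"
proof -
  have "(\<Sum>d<K. card {a \<in> A. d < c a}) = (\<Sum>a\<in>A. card {d \<in> {..<K}. d < c a})"
    using assms by (intro sum_multicount_gen) auto
  also have "\<dots> \<le> (\<Sum>a\<in>A. card {..<c a})"
    by (intro sum_mono card_mono) auto
  finally show ?thesis
    by simp
qed

lemma mult_card_le_sum_of_card_fibre_le:
  fixes c :: "'a \<Rightarrow> nat"
  assumes "finite A"
    and pos: "\<And>a. a \<in> A \<Longrightarrow> 0 < c a"
    and fibre: "\<And>d. card {a \<in> A. c a = d} \<le> n"
  shows "K * card A \<le> (\<Sum>a\<in>A. c a) + n * (\<Sum>d<K. d)"
proof -
  have split: "card {a \<in> A. d < c a} + card {a \<in> A. c a \<le> d} = card A" for d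
  proof -
    have "{a \<in> A. d < c a} \<union> {a \<in> A. c a \<le> d} = A"
      by auto
    then show ?thesis
      using \<open>finite A\<close> card_Un_disjoint[of "{a \<in> A. d < c a}" "{a \<in> A. c a \<le> d}"] by fastforce
  qed
  have "K * card A = (\<Sum>d<K. card {a \<in> A. d < c a}) + (\<Sum>d<K. card {a \<in> A. c a \<le> d})"
    by (simp add: sum.distrib[symmetric] split)
  also have "\<dots> \<le> (\<Sum>a\<in>A. c a) + (\<Sum>d<K. n * d)"
    by (intro add_mono sum_card_greater_le_sum \<open>finite A\<close> sum_mono
        card_le_mult_of_card_fibre_le pos fibre)
  finally show ?thesis
    by (simp add: sum_distrib_left)
qed

lemma sum_ge_of_card_fibre_le:
  fixes c :: "'a \<Rightarrow> nat"
  assumes "finite A" "0 < n"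
    and pos: "\<And>a. a \<in> A \<Longrightarrow> 0 < c a"
    and fibre: "\<And>d. card {a \<in> A. c a = d} \<le> n"
  shows "(real (card A))\<^sup>2 / (2 * real n) + real (card A) / 2 \<le> real (\<Sum>a\<in>A. c a)"
proof -
  define x where "x = real (card A) / real n"
  \<comment> \<open>For real \<open>K\<close>, \<open>2 K x - K (K - 1)\<close> is maximal at \<open>K = x + 1/2\<close>; a nearest integer is \<open>\<lceil>x\<rceil>\<close>.\<close>
  define K where "K = nat \<lceil>x\<rceil>"
  have card_A: "real (card A) = real n * x"
    using \<open>0 < n\<close> by (simp add: x_def)
  have "0 \<le> x"
    by (simp add: x_def)
  then have "real K - 1 \<le> x" "x \<le> real K"
    unfolding K_def by linarith+
  then have "(x - real K) * (x - real K + 1) \<le> 0"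
    by (intro mult_nonpos_nonneg) auto
  then have "x * (x + 1) \<le> 2 * real K * x - real K * (real K - 1)"
    by (simp add: algebra_simps)
  then have "real n * (x * (x + 1)) \<le> real n * (2 * real K * x - real K * (real K - 1))"
    by (intro mult_left_mono) auto
  also have "\<dots> \<le> 2 * real (\<Sum>a\<in>A. c a)"
  proof -
    have "real K * real (card A) \<le> real (\<Sum>a\<in>A. c a) + real n * real (\<Sum>d<K. d)"
      using mult_card_le_sum_of_card_fibre_le[OF \<open>finite A\<close> pos fibre, of K]
      by (metis of_nat_add of_nat_le_iff of_nat_mult)
    moreover have gauss: "2 * real (\<Sum>d<K. d) = real K * (real K - 1)"
      by (induction K) (auto simp: algebra_simps)
    ultimately show ?thesis
      unfolding card_A gauss[symmetric] by (simp add: algebra_simps)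
  qed
  finally show ?thesis
    using \<open>0 < n\<close> unfolding card_A by (simp add: field_simps power2_eq_square)
qed

section \<open>Topological numberings\<close>

lemma finite_acyclic_ex_maximal:
  assumes "finite A" "acyclic r" "A \<noteq> {}"
  shows "\<exists>z\<in>A. \<forall>y\<in>A. (z, y) \<notin> r"
proof -
  have "finite (r \<inter> A \<times> A)"
    using \<open>finite A\<close> by blast
  moreover have "acyclic (r \<inter> A \<times> A)"
    using \<open>acyclic r\<close> by (rule acyclic_subset) blast
  ultimately have "wf ((r \<inter> A \<times> A)\<inverse>)"
    by (rule finite_acyclic_wf_converse)
  then obtain z where "z \<in> A" "\<And>y. (y, z) \<in> (r \<inter> A \<times> A)\<inverse> \<Longrightarrow> y \<notin> A"
    using \<open>A \<noteq> {}\<close> by (metis wfE_min')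
  then show ?thesis
    by blast
qed

lemma finite_acyclic_ex_topological_numbering:
  assumes "finite A" "acyclic r"
  shows "\<exists>f. bij_betw f A {..<card A} \<and> (\<forall>x\<in>A. \<forall>y\<in>A. (x, y) \<in> r \<longrightarrow> f x < f y)"
  using \<open>finite A\<close>
proof (induction A rule: finite_psubset_induct)
  case (psubset A)
  show ?case
  proof (cases "A = {}")
    case True
    then show ?thesis
      by (simp add: bij_betw_def)
  next
    case False
    then obtain z where z: "z \<in> A" "\<And>y. y \<in> A \<Longrightarrow> (z, y) \<notin> r"
      using finite_acyclic_ex_maximal[OF \<open>finite A\<close> \<open>acyclic r\<close>] by blast
    define k where "k = card (A - {z})"
    have "A - {z} \<subset> A"
      using z(1) by blast
    then obtain f where bij: "bij_betw f (A - {z}) {..<k}"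
      and mono: "\<And>x y. x \<in> A - {z} \<Longrightarrow> y \<in> A - {z} \<Longrightarrow> (x, y) \<in> r \<Longrightarrow> f x < f y"
      using psubset.IH unfolding k_def by meson
    let ?g = "f(z := k)"
    have "bij_betw ?g (A - {z}) {..<k}"
      using bij by (rule bij_betw_cong[THEN iffD1, rotated]) simp
    then have "bij_betw ?g (A - {z} \<union> {z}) ({..<k} \<union> {k})"
      using notIn_Un_bij_betw3[of z "A - {z}" ?g "{..<k}"] by simp
    moreover have "A - {z} \<union> {z} = A"
      using z(1) by blast
    moreover have "{..<k} \<union> {k} = {..<card A}"
      using card.remove[OF \<open>finite A\<close> z(1)] unfolding k_def by auto
    moreover have "?g x < ?g y" if "x \<in> A" "y \<in> A" "(x, y) \<in> r" for x y
      using that z(2) mono bij_betwE[OF bij] by auto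
    ultimately show ?thesis
      by metis
  qed
qed

section \<open>Feedback arc sets and backward arcs\<close>

definition backward_arcs :: "('a, 'b) pre_digraph \<Rightarrow> ('a \<Rightarrow> 'c :: ord) \<Rightarrow> 'b set" where
  "backward_arcs G f = {e \<in> arcs G. f (head G e) < f (tail G e)}"

lemma (in wf_digraph) no_cycle_imp_acyclic:
  assumes "\<nexists>p. cycle p"
  shows "acyclic (arcs_ends G)"
proof (rule acyclicI, intro allI notI)
  fix u assume "u \<rightarrow>\<^sup>+ u"
  then obtain p where "awalk u p u" "p \<noteq> []"
    unfolding reachable1_awalk by blast
  then have "closed_w p"
    unfolding closed_w_def by auto
  with assms show False
    using closed_w_imp_cycle by blast
qed

lemma (in wf_digraph) wf_digraph_del_arcs: "wf_digraph (del_arcs G F)"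
  by unfold_locales (auto simp: del_arcs_def)

lemma (in fin_digraph) feedback_arc_set_ex_numbering:
  assumes "feedback_arc_set G F"
  shows "\<exists>f. bij_betw f (verts G) {..<card (verts G)} \<and> backward_arcs G f \<subseteq> F"
proof -
  have "acyclic (arcs_ends (del_arcs G F))"
    using assms wf_digraph.no_cycle_imp_acyclic[OF wf_digraph_del_arcs]
    by (simp add: feedback_arc_set_def)
  then obtain f where bij: "bij_betw f (verts G) {..<card (verts G)}"
    and mono: "\<And>x y. x \<in> verts G \<Longrightarrow> y \<in> verts G \<Longrightarrow> (x, y) \<in> arcs_ends (del_arcs G F) \<Longrightarrow> f x < f y"
    using finite_acyclic_ex_topological_numbering[OF finite_verts] by meson
  have "f (tail G e) < f (head G e)" if "e \<in> arcs G - F" for e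
    using that by (intro mono) (auto simp: arcs_ends_conv del_arcs_def)
  then have "backward_arcs G f \<subseteq> F"
    unfolding backward_arcs_def by (force dest: less_asym)
  with bij show ?thesis
    by blast
qed

lemma (in fin_digraph) min_feedback_attained:
  "\<exists>F. feedback_arc_set G F \<and> card F = \<beta> G"
proof -
  have "feedback_arc_set G (arcs G)"
    by (auto simp: feedback_arc_set_def del_arcs_def pre_digraph.cycle_def pre_digraph.awalk_def)
  moreover have "finite {F. feedback_arc_set G F}"
    by (rule finite_subset[of _ "Pow (arcs G)"]) (auto simp: feedback_arc_set_def)
  ultimately have "\<beta> G \<in> card ` {F. feedback_arc_set G F}"
    unfolding min_feedback_def by (intro Min_in) auto
  then show ?thesis
    by auto
qed

lemma (in fin_digraph) ex_numbering_card_backward_arcs_le_min_feedback: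
  "\<exists>f. bij_betw f (verts G) {..<card (verts G)} \<and> card (backward_arcs G f) \<le> \<beta> G"
proof -
  obtain F where F: "feedback_arc_set G F" "card F = \<beta> G"
    using min_feedback_attained by blast
  obtain f where f: "bij_betw f (verts G) {..<card (verts G)}" "backward_arcs G f \<subseteq> F"
    using feedback_arc_set_ex_numbering[OF F(1)] by blast
  have "finite F"
    using F(1) finite_subset[OF _ finite_arcs] unfolding feedback_arc_set_def by blast
  then have "card (backward_arcs G f) \<le> \<beta> G"
    using card_mono[OF _ f(2)] F(2) by simp
  with f(1) show ?thesis
    by blast
qed

section \<open>Cyclic lengths of arcs in Eulerian digraphs\<close>

definition cyclic_dist :: "nat \<Rightarrow> nat \<Rightarrow> nat \<Rightarrow> nat" where
  "cyclic_dist n i j = (n + j - i) mod n"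

lemma cyclic_dist_add:
  assumes "i < n" "j < n"
  shows "cyclic_dist n i j + i = (if j < i then n else 0) + j"
proof (cases "j < i")
  case True
  with assms show ?thesis
    by (simp add: cyclic_dist_def)
next
  case False
  then have "n + j - i = (j - i) + n"
    by simp
  then have "cyclic_dist n i j = j - i"
    using assms(2) unfolding cyclic_dist_def by (metis less_imp_diff_less mod_add_self2 mod_less)
  with False show ?thesis
    by simp
qed

lemma cyclic_dist_pos:
  assumes "i < n" "j < n" "i \<noteq> j"
  shows "0 < cyclic_dist n i j"
  using cyclic_dist_add[OF assms(1,2)] assms by (auto split: if_splits)

lemma inj_on_cyclic_dist:
  assumes "i < n"
  shows "inj_on (cyclic_dist n i) {..<n}"
proof (rule inj_onI)
  fix j k
  assume jk: "j \<in> {..<n}" "k \<in> {..<n}" and "cyclic_dist n i j = cyclic_dist n i k"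
  then have "(if j < i then n else 0) + j = (if k < i then n else 0) + k"
    using assms cyclic_dist_add by (metis lessThan_iff)
  then show "j = k"
    using jk by (auto split: if_splits)
qed

definition cyclic_length :: "('a, 'b) pre_digraph \<Rightarrow> nat \<Rightarrow> ('a \<Rightarrow> nat) \<Rightarrow> 'b \<Rightarrow> nat" where
  "cyclic_length G n f e = cyclic_dist n (f (tail G e)) (f (head G e))"

lemma (in loopfree_digraph) cyclic_length_pos:
  assumes "inj_on f (verts G)" "f ` verts G \<subseteq> {..<n}" "e \<in> arcs G"
  shows "0 < cyclic_length G n f e"
proof -
  have "f (tail G e) \<noteq> f (head G e)"
    using assms(1,3) no_loops by (simp add: inj_on_eq_iff)
  then show ?thesis
    using assms(2,3) unfolding cyclic_length_def by (intro cyclic_dist_pos) (auto simp: image_subset_iff)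
qed

lemma (in nomulti_digraph) inj_on_tail_cyclic_length_fibre:
  assumes "inj_on f (verts G)" "f ` verts G \<subseteq> {..<n}"
  shows "inj_on (tail G) {e \<in> arcs G. cyclic_length G n f e = d}"
proof (rule inj_onI)
  fix e e'
  assume "e \<in> {e \<in> arcs G. cyclic_length G n f e = d}"
    and "e' \<in> {e \<in> arcs G. cyclic_length G n f e = d}"
    and tails: "tail G e = tail G e'"
  then have e: "e \<in> arcs G" "e' \<in> arcs G"
    and lengths: "cyclic_length G n f e = cyclic_length G n f e'"
    by auto
  have "inj_on (cyclic_dist n (f (tail G e))) {..<n}"
    using assms(2) e by (intro inj_on_cyclic_dist) (auto simp: image_subset_iff)
  then have "f (head G e) = f (head G e')"
    using assms(2) e lengths tails unfolding cyclic_length_def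
    by (auto dest!: inj_onD simp: image_subset_iff)
  then have "head G e = head G e'"
    using assms(1) e by (simp add: inj_on_eq_iff)
  with tails show "e = e'"
    using no_multi_arcs[OF e] by (simp add: arc_to_ends_def)
qed

lemma (in digraph) card_cyclic_length_fibre_le:
  assumes "inj_on f (verts G)" "f ` verts G \<subseteq> {..<n}"
  shows "card {e \<in> arcs G. cyclic_length G n f e = d} \<le> card (verts G)"
  using inj_on_tail_cyclic_length_fibre[OF assms] by (rule card_inj_on_le) auto

lemma (in fin_digraph) eulerian_sum_head_eq_sum_tail:
  fixes f :: "'a \<Rightarrow> 'c :: semiring_1"
  assumes "eulerian G"
  shows "(\<Sum>e\<in>arcs G. f (head G e)) = (\<Sum>e\<in>arcs G. f (tail G e))"
proof -
  have "(\<Sum>e\<in>arcs G. f (head G e)) = (\<Sum>v\<in>verts G. \<Sum>e\<in>in_arcs G v. f (head G e))"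
    unfolding in_arcs_def by (intro sum.group[symmetric]) auto
  also have "\<dots> = (\<Sum>v\<in>verts G. of_nat (in_degree G v) * f v)"
    by (simp add: in_degree_def)
  also have "\<dots> = (\<Sum>v\<in>verts G. of_nat (out_degree G v) * f v)"
    using assms by (simp add: eulerian_def)
  also have "\<dots> = (\<Sum>v\<in>verts G. \<Sum>e\<in>out_arcs G v. f (tail G e))"
    by (simp add: out_degree_def)
  also have "\<dots> = (\<Sum>e\<in>arcs G. f (tail G e))"
    unfolding out_arcs_def by (intro sum.group) auto
  finally show ?thesis .
qed

lemma (in fin_digraph) eulerian_sum_cyclic_length:
  assumes "eulerian G" "f ` verts G \<subseteq> {..<n}"
  shows "(\<Sum>e\<in>arcs G. cyclic_length G n f e) = n * card (backward_arcs G f)"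
proof -
  have "(\<Sum>e\<in>arcs G. cyclic_length G n f e) + (\<Sum>e\<in>arcs G. f (tail G e))
      = (\<Sum>e\<in>arcs G. (if f (head G e) < f (tail G e) then n else 0) + f (head G e))"
    using assms(2) unfolding sum.distrib[symmetric] cyclic_length_def
    by (intro sum.cong cyclic_dist_add) (auto simp: image_subset_iff)
  also have "\<dots> = n * card (backward_arcs G f) + (\<Sum>e\<in>arcs G. f (head G e))"
    by (simp add: sum.distrib sum.If_cases backward_arcs_def Int_def)
  also have "(\<Sum>e\<in>arcs G. f (head G e)) = (\<Sum>e\<in>arcs G. f (tail G e))"
    using eulerian_sum_head_eq_sum_tail[OF assms(1), of f] by simp
  finally show ?thesis
    by simp
qed

lemma (in digraph) eulerian_card_backward_arcs_ge:
  fixes n m :: nat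
  assumes "eulerian G" and bij: "bij_betw f (verts G) {..<n}" and m: "m = card (arcs G)"
  shows "(real m)\<^sup>2 / (2 * (real n)\<^sup>2) + real m / (2 * real n) \<le> real (card (backward_arcs G f))"
proof (cases "n = 0")
  case False
  have f: "inj_on f (verts G)" "f ` verts G \<subseteq> {..<n}" and n: "card (verts G) = n"
    using bij bij_betw_same_card[OF bij] by (auto simp: bij_betw_def)
  have "(real m)\<^sup>2 / (2 * real n) + real m / 2 \<le> real (\<Sum>e\<in>arcs G. cyclic_length G n f e)"
    unfolding m using False cyclic_length_pos[OF f] card_cyclic_length_fibre_le[OF f]
    by (intro sum_ge_of_card_fibre_le) (auto simp: n)
  also have "\<dots> = real n * real (card (backward_arcs G f))"
    using eulerian_sum_cyclic_length[OF \<open>eulerian G\<close> f(2)] by simp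
  finally show ?thesis
    using False by (simp add: field_simps power2_eq_square)
qed simp

theorem theorem1p1:
  fixes G :: "('a, 'b) pre_digraph" and n m :: nat
  assumes "digraph G"
    and "eulerian G"
    and "n = card (verts G)"
    and "m = card (arcs G)"
  shows "real (\<beta> G) \<ge> (real m)\<^sup>2 / (2 * (real n)\<^sup>2) + real m / (2 * real n)"
proof -
  interpret digraph G
    by fact
  obtain f where bij: "bij_betw f (verts G) {..<n}" and "card (backward_arcs G f) \<le> \<beta> G"
    using ex_numbering_card_backward_arcs_le_min_feedback assms(3) by blast
  then have "real (card (backward_arcs G f)) \<le> real (\<beta> G)"
    by simp
  with eulerian_card_backward_arcs_ge[OF \<open>eulerian G\<close> bij assms(4)] show ?thesis
    by (rule order_trans)
qed

end
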